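(* Let $\mathit{ADG}=(\mathcal{S},V,D,C,\mathit{Cap})$ be an Agent Dependency Graph and $\mathcal{A}\subseteq\mathcal{C}$ a set of allowed capabilities. Let $\Phi$ be the conjunction of all clauses (C1)–(C5) listed in the context. Then: 1. $\Phi$ is satisfiable if and only if a secure installation exists. 2. Any satisfying assignment $\sigma\models\Phi$ induces a secure installation $I_\sigma=\{(s,v)\mid\sigma(x_{s,v})=\mathit{true}\}$, and the corresponding lockfile $\mathcal{L}_\sigma=(I_\sigma,H,M)$ satisfies all dependency, conflict, and capability constraints.
   Context: Version constraints: a version constraint $\gamma$ is a predicate on version numbers, namely a conjunction of atomic predicates comparing with a fixed version (==, !=, >=, <=, >, <, caret and tilde compatibility ranges) or the always-true wildcard; $w\models\gamma$ means that version $w$ satisfies $\gamma$. Agent Dependency Graph: a tuple $(\mathcal{S},V,D,C,\mathit{Cap})$ where $\mathcal{S}$ is a finite set of skill names; $V:\mathcal{S}\to 2^{\mathbb{N}}$ maps each skill to its set of available versions (ordered by semantic versioning precedence); $D$ maps each pair $(s,v)\in\mathcal{S}\times\mathbb{N}$ to a set of dependency edges $(q,\gamma)$, with $q\in\mathcal{S}$ and $\gamma$ a constraint, each requiring that some version of $q$ satisfying $\gamma$ be co-installed; $C$ maps each pair $(s,v)$ to a set of conflict edges $(q,\gamma)$, each meaning that no version of $q$ satisfying $\gamma$ may be co-installed with $(s,v)$; and $\mathit{Cap}$ maps each $(s,v)$ to the subset of the capability universe $\mathcal{C}$ that it requires at runtime. SAT encoding: a Boolean variable $x_{s,v}$ for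 each $s\in\mathcal{S}$ and $v\in V(s)$ (true meaning that skill $s$ at version $v$ is included in the installation), with the following clauses. (C1) At most one version: for each skill $s$ and every pair of distinct versions $v_i,v_j\in V(s)$: $\neg x_{s,v_i}\lor\neg x_{s,v_j}$. (C2) Root requirements: for each user-specified requirement $(s,\gamma)$ (a skill with a version constraint): $\bigvee_{w\in V(s),\,w\models\gamma}x_{s,w}$. (C3) Dependencies: for each $(s,v)$ and each $(q,\gamma)\in D(s,v)$: $\neg x_{s,v}\lor\bigvee_{w\in V(q),\,w\models\gamma}x_{q,w}$ (which is the unit clause $\neg x_{s,v}$ if no version of $q$ satisfies $\gamma$). (C4) Conflicts: for each $(s,v)$, each $(q,\gamma)\in C(s,v)$ and each $w\in V(q)$ with $w\models\gamma$: $\neg x_{s,v}\lor\neg x_{q,w}$. (C5) Capability bounds: for each $(s,v)$ with $\mathit{Cap}(s,v)\not\subseteq\mathcal{A}$: $\neg x_{s,v}$. Installation: a set $I\subseteq\mathcal{S}\times\mathbb{N}$ of skill-version pairs. It is secure with respect to $(\mathcal{S},V,D,C,\mathit{Cap},\mathcal{A})$ if and only if: (1) Completeness: for every $(s,v)\in I$ and every $(q,\gamma)\in D(s,v)$ there exists $(q,w)\in I$ with $w\models\gamma$; (2) Consistency: for every $(s,v)\in I$ and every $(q,\gamma)\in C(s,v)$ there is no $(q,w)\in I$ with $w\models\gamma$; (3) Capability safety: for every $(s,v)\in I$, $\mathit{Cap}(s,v)\subseteq\mathcal{A}$. Lockfile: a tuple $(I,H,M)$ where $I$ is a secure installation, $H:I\to\{0,1\}^{256}$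 maps each installed skill-version to its SHA-256 content hash, and $M$ is a metadata record containing the resolution strategy, the allowed capability set $\mathcal{A}$, a generation timestamp and the tool version.
   Formalization: In part 1, "a secure installation exists" is read as one that also uses only available versions, at most one per skill, and meets all root requirements; literally the claim fails, since the empty installation is always secure while a root with no matching version makes Φ unsatisfiable. *)

theory Defs
  imports Main "HOL-Library.Product_Lexorder" "HOL-Library.Word"
begin

section \<open>Versions and version constraints\<close>

text \<open>
  A semantic version is a triple (major, minor, patch).  The lexicographic order that
  \<^theory>\<open>HOL-Library.Product_Lexorder\<close> puts on products is semantic versioning precedence.
\<close>

type_synonym semver = "nat \<times> nat \<times> nat"

datatype atomic =
    Eq semver | Neq semver | Ge semver | Le semver | Gt semver | Lt semver
  | Caret semver | Tilde semver

datatype vconstraint = Wildcard | Conj "atomic list"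

text \<open>
  Exclusive upper ends of the compatibility ranges: a caret range keeps the leftmost nonzero
  component fixed, a tilde range keeps major and minor fixed.
\<close>

fun caret_bound :: "semver \<Rightarrow> semver" where
  "caret_bound (ma, mi, pa) =
     (if ma \<noteq> 0 then (ma + 1, 0, 0)
      else if mi \<noteq> 0 then (0, mi + 1, 0)
      else (0, 0, pa + 1))"

fun tilde_bound :: "semver \<Rightarrow> semver" where
  "tilde_bound (ma, mi, pa) = (ma, mi + 1, 0)"

fun models_atomic :: "semver \<Rightarrow> atomic \<Rightarrow> bool" where
  "models_atomic w (Eq u) \<longleftrightarrow> w = u"
| "models_atomic w (Neq u) \<longleftrightarrow> w \<noteq> u"
| "models_atomic w (Ge u) \<longleftrightarrow> u \<le> w"
| "models_atomic w (Le u) \<longleftrightarrow> w \<le> u"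
| "models_atomic w (Gt u) \<longleftrightarrow> u < w"
| "models_atomic w (Lt u) \<longleftrightarrow> w < u"
| "models_atomic w (Caret u) \<longleftrightarrow> u \<le> w \<and> w < caret_bound u"
| "models_atomic w (Tilde u) \<longleftrightarrow> u \<le> w \<and> w < tilde_bound u"

text \<open>
  Versions of skills are natural numbers; \<open>sv\<close> gives the semantic version that a number
  stands for.  It is an arbitrary parameter throughout: nothing depends on the numbering chosen.
\<close>

fun models_constraint :: "(nat \<Rightarrow> semver) \<Rightarrow> nat \<Rightarrow> vconstraint \<Rightarrow> bool" where
  "models_constraint sv w Wildcard \<longleftrightarrow> True"
| "models_constraint sv w (Conj as) \<longleftrightarrow> (\<forall>a\<in>set as. models_atomic (sv w) a)"


section \<open>Agent dependency graphs\<close>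

record ('s, 'c) adg =
  skills :: "'s set"
  versions :: "'s \<Rightarrow> nat set"
  deps :: "'s \<times> nat \<Rightarrow> ('s \<times> vconstraint) set"
  conflicts :: "'s \<times> nat \<Rightarrow> ('s \<times> vconstraint) set"
  caps :: "'s \<times> nat \<Rightarrow> 'c set"

text \<open>
  \<open>CU\<close> is the capability universe.  The fields of the record are total functions; only their
  values on \<^term>\<open>skills G\<close> matter.
\<close>

definition is_adg :: "'c set \<Rightarrow> ('s, 'c) adg \<Rightarrow> bool" where
  "is_adg CU G \<longleftrightarrow>
     finite (skills G) \<and>
     (\<forall>s\<in>skills G. \<forall>v.
        (\<forall>(q, \<gamma>)\<in>deps G (s, v). q \<in> skills G) \<and>
        (\<forall>(q, \<gamma>)\<in>conflicts G (s, v). q \<in> skills G) \<and>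
        caps G (s, v) \<subseteq> CU)"


section \<open>Propositional formulas in conjunctive normal form\<close>

text \<open>
  Clauses are sets of literals, read disjunctively, and formulas are sets of clauses, read
  conjunctively.  Neither is required to be finite, since \<^term>\<open>versions G s\<close> may be infinite.
\<close>

datatype 'x literal = Pos 'x | Neg 'x

type_synonym 'x clause = "'x literal set"
type_synonym 'x cnf = "'x clause set"

fun sat_literal :: "('x \<Rightarrow> bool) \<Rightarrow> 'x literal \<Rightarrow> bool" where
  "sat_literal \<sigma> (Pos x) \<longleftrightarrow> \<sigma> x"
| "sat_literal \<sigma> (Neg x) \<longleftrightarrow> \<not> \<sigma> x"

definition sat_clause :: "('x \<Rightarrow> bool) \<Rightarrow> 'x clause \<Rightarrow> bool" where
  "sat_clause \<sigma> c \<longleftrightarrow> (\<exists>l\<in>c. sat_literal \<sigma> l)"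

definition sat_cnf :: "('x \<Rightarrow> bool) \<Rightarrow> 'x cnf \<Rightarrow> bool" where
  "sat_cnf \<sigma> F \<longleftrightarrow> (\<forall>c\<in>F. sat_clause \<sigma> c)"

definition satisfiable :: "'x cnf \<Rightarrow> bool" where
  "satisfiable F \<longleftrightarrow> (\<exists>\<sigma>. sat_cnf \<sigma> F)"


section \<open>The SAT encoding\<close>

text \<open>
  The variable $x_{s,v}$ is the pair \<open>(s, v)\<close>, for \<open>s\<close> a skill and \<open>v\<close> one of its
  available versions.
\<close>

definition sat_vars :: "('s, 'c) adg \<Rightarrow> ('s \<times> nat) set" where
  "sat_vars G = {(s, v). s \<in> skills G \<and> v \<in> versions G s}"

definition candidates ::
  "(nat \<Rightarrow> semver) \<Rightarrow> ('s, 'c) adg \<Rightarrow> 's \<Rightarrow> vconstraint \<Rightarrow> ('s \<times> nat) literal set" where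
  "candidates sv G q \<gamma> = {Pos (q, w) | w. w \<in> versions G q \<and> models_constraint sv w \<gamma>}"

definition C1 :: "('s, 'c) adg \<Rightarrow> ('s \<times> nat) cnf" where
  "C1 G = {{Neg (s, v), Neg (s, w)} | s v w.
             s \<in> skills G \<and> v \<in> versions G s \<and> w \<in> versions G s \<and> v \<noteq> w}"

definition C2 ::
  "(nat \<Rightarrow> semver) \<Rightarrow> ('s, 'c) adg \<Rightarrow> ('s \<times> vconstraint) set \<Rightarrow> ('s \<times> nat) cnf" where
  "C2 sv G R = {candidates sv G s \<gamma> | s \<gamma>. (s, \<gamma>) \<in> R}"

definition C3 :: "(nat \<Rightarrow> semver) \<Rightarrow> ('s, 'c) adg \<Rightarrow> ('s \<times> nat) cnf" where
  "C3 sv G = {insert (Neg (s, v)) (candidates sv G q \<gamma>) | s v q \<gamma>.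
                (s, v) \<in> sat_vars G \<and> (q, \<gamma>) \<in> deps G (s, v)}"

definition C4 :: "(nat \<Rightarrow> semver) \<Rightarrow> ('s, 'c) adg \<Rightarrow> ('s \<times> nat) cnf" where
  "C4 sv G = {{Neg (s, v), Neg (q, w)} | s v q \<gamma> w.
                (s, v) \<in> sat_vars G \<and> (q, \<gamma>) \<in> conflicts G (s, v) \<and>
                w \<in> versions G q \<and> models_constraint sv w \<gamma>}"

definition C5 :: "('s, 'c) adg \<Rightarrow> 'c set \<Rightarrow> ('s \<times> nat) cnf" where
  "C5 G A = {{Neg (s, v)} | s v. (s, v) \<in> sat_vars G \<and> \<not> caps G (s, v) \<subseteq> A}"

definition encoding ::
  "(nat \<Rightarrow> semver) \<Rightarrow> ('s, 'c) adg \<Rightarrow> ('s \<times> vconstraint) set \<Rightarrow> 'c set \<Rightarrow> ('s \<times> nat) cnf" where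
  "encoding sv G R A = C1 G \<union> C2 sv G R \<union> C3 sv G \<union> C4 sv G \<union> C5 G A"

text \<open>
  An assignment is a total function on pairs, so the values at pairs that are not variables of
  the encoding have to be ignored here.
\<close>

definition induced :: "('s, 'c) adg \<Rightarrow> ('s \<times> nat \<Rightarrow> bool) \<Rightarrow> ('s \<times> nat) set" where
  "induced G \<sigma> = {p \<in> sat_vars G. \<sigma> p}"


section \<open>Installations\<close>

definition installation :: "('s, 'c) adg \<Rightarrow> ('s \<times> nat) set \<Rightarrow> bool" where
  "installation G I \<longleftrightarrow> I \<subseteq> skills G \<times> UNIV"

definition dependency_complete :: "(nat \<Rightarrow> semver) \<Rightarrow> ('s, 'c) adg \<Rightarrow> ('s \<times> nat) set \<Rightarrow> bool" where
  "dependency_complete sv G I \<longleftrightarrow>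
     (\<forall>p\<in>I. \<forall>(q, \<gamma>)\<in>deps G p. \<exists>w. (q, w) \<in> I \<and> models_constraint sv w \<gamma>)"

definition consistent :: "(nat \<Rightarrow> semver) \<Rightarrow> ('s, 'c) adg \<Rightarrow> ('s \<times> nat) set \<Rightarrow> bool" where
  "consistent sv G I \<longleftrightarrow>
     (\<forall>p\<in>I. \<forall>(q, \<gamma>)\<in>conflicts G p. \<not> (\<exists>w. (q, w) \<in> I \<and> models_constraint sv w \<gamma>))"

definition capability_safe :: "('s, 'c) adg \<Rightarrow> 'c set \<Rightarrow> ('s \<times> nat) set \<Rightarrow> bool" where
  "capability_safe G A I \<longleftrightarrow> (\<forall>p\<in>I. caps G p \<subseteq> A)"

definition secure ::
  "(nat \<Rightarrow> semver) \<Rightarrow> ('s, 'c) adg \<Rightarrow> 'c set \<Rightarrow> ('s \<times> nat) set \<Rightarrow> bool" where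
  "secure sv G A I \<longleftrightarrow>
     installation G I \<and> dependency_complete sv G I \<and> consistent sv G I \<and> capability_safe G A I"

text \<open>
  Security alone says nothing about the root requirements \<open>R\<close>: the empty installation is
  always secure.  Nor does it exclude unavailable versions or two versions of one skill.
  The installations that the encoding searches for answer a resolution request: they consist of
  available versions, at most one per skill, and meet every root requirement.
\<close>

definition resolves ::
  "(nat \<Rightarrow> semver) \<Rightarrow> ('s, 'c) adg \<Rightarrow> ('s \<times> vconstraint) set \<Rightarrow> ('s \<times> nat) set \<Rightarrow> bool" where
  "resolves sv G R I \<longleftrightarrow>
     (\<forall>(s, v)\<in>I. v \<in> versions G s) \<and>
     (\<forall>s v w. (s, v) \<in> I \<longrightarrow> (s, w) \<in> I \<longrightarrow> v = w) \<and>
     (\<forall>(s, \<gamma>)\<in>R. \<exists>w. (s, w) \<in> I \<and> models_constraint sv w \<gamma>)"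


section \<open>Lockfiles\<close>

record 'c metadata =
  strategy :: string
  allowed :: "'c set"
  timestamp :: int
  tool_version :: string

record ('s, 'c) lockfile =
  installed :: "('s \<times> nat) set"
  hashes :: "'s \<times> nat \<Rightarrow> 256 word option"
  meta :: "'c metadata"

text \<open>
  \<open>content\<close> is the byte content of each skill version and \<open>sha\<close> the hash function.  Both are
  arbitrary parameters; no property of SHA-256 other than its output length is used.
\<close>

definition hash_map ::
  "(8 word list \<Rightarrow> 256 word) \<Rightarrow> ('s \<times> nat \<Rightarrow> 8 word list) \<Rightarrow> ('s \<times> nat) set \<Rightarrow>
   's \<times> nat \<Rightarrow> 256 word option" where
  "hash_map sha content I = (\<lambda>p. Some (sha (content p))) |` I"

definition is_lockfile ::
  "(nat \<Rightarrow> semver) \<Rightarrow> (8 word list \<Rightarrow> 256 word) \<Rightarrow> ('s \<times> nat \<Rightarrow> 8 word list) \<Rightarrow>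
   ('s, 'c) adg \<Rightarrow> 'c set \<Rightarrow> ('s, 'c) lockfile \<Rightarrow> bool" where
  "is_lockfile sv sha content G A L \<longleftrightarrow>
     secure sv G A (installed L) \<and>
     hashes L = hash_map sha content (installed L) \<and>
     allowed (meta L) = A"

definition induced_lockfile ::
  "(8 word list \<Rightarrow> 256 word) \<Rightarrow> ('s \<times> nat \<Rightarrow> 8 word list) \<Rightarrow> ('s, 'c) adg \<Rightarrow>
   'c metadata \<Rightarrow> ('s \<times> nat \<Rightarrow> bool) \<Rightarrow> ('s, 'c) lockfile" where
  "induced_lockfile sha content G M \<sigma> =
     \<lparr>installed = induced G \<sigma>, hashes = hash_map sha content (induced G \<sigma>), meta = M\<rparr>"

end

theory Submission
  imports Defs
begin

text \<open>
  Read through \<^term>\<open>induced G \<sigma>\<close>, each family of clauses is one condition on installations: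
  C1 and C2 are uniqueness and the root requirements of \<^const>\<open>resolves\<close>, and C3, C4, C5 are
  completeness, consistency and capability safety.  Installations of available versions are
  exactly the sets of the form \<^term>\<open>induced G \<sigma>\<close>.
\<close>

lemma sat_cnf_Un [simp]: "sat_cnf \<sigma> (F \<union> F') \<longleftrightarrow> sat_cnf \<sigma> F \<and> sat_cnf \<sigma> F'"
  unfolding sat_cnf_def by blast

lemma sat_clause_empty [simp]: "\<not> sat_clause \<sigma> {}"
  by (simp add: sat_clause_def)

lemma sat_clause_insert [simp]:
  "sat_clause \<sigma> (insert l c) \<longleftrightarrow> sat_literal \<sigma> l \<or> sat_clause \<sigma> c"
  by (simp add: sat_clause_def)

lemma mem_induced_iff:
  "(s, v) \<in> induced G \<sigma> \<longleftrightarrow> s \<in> skills G \<and> v \<in> versions G s \<and> \<sigma> (s, v)"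
  by (auto simp: induced_def sat_vars_def)

text \<open>Passing to the characteristic function inverts \<open>induced\<close> on sets of
  variables. The inclusion is essential, since \<open>induced\<close> discards every pair outside
  \<open>sat_vars G\<close>.\<close>

lemma induced_mem:
  assumes "I \<subseteq> sat_vars G"
  shows "induced G (\<lambda>p. p \<in> I) = I"
  using assms by (auto simp: induced_def)

lemma installation_induced: "installation G (induced G \<sigma>)"
  by (auto simp: installation_def mem_induced_iff)

text \<open>\<open>candidates\<close> checks only that \<open>w\<close> is an available version of
  \<open>q\<close>, whereas \<open>induced\<close> also checks that \<open>q\<close> is a skill; the
  assumption makes the two agree. If no version matches, the clause is empty and both sides are
  false.\<close>

lemma sat_candidates_iff:
  assumes "q \<in> skills G"
  shows "sat_clause \<sigma> (candidates sv G q \<gamma>) \<longleftrightarrow>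
    (\<exists>w. (q, w) \<in> induced G \<sigma> \<and> models_constraint sv w \<gamma>)"
  using assms by (auto simp: sat_clause_def candidates_def mem_induced_iff)

lemma sat_C1_iff:
  "sat_cnf \<sigma> (C1 G) \<longleftrightarrow>
    (\<forall>s v w. (s, v) \<in> induced G \<sigma> \<longrightarrow> (s, w) \<in> induced G \<sigma> \<longrightarrow> v = w)"
proof -
  have "sat_cnf \<sigma> (C1 G) \<longleftrightarrow>
    (\<forall>s v w. s \<in> skills G \<and> v \<in> versions G s \<and> w \<in> versions G s \<and> v \<noteq> w \<longrightarrow>
      sat_clause \<sigma> {Neg (s, v), Neg (s, w)})"
    unfolding sat_cnf_def C1_def by blast
  then show ?thesis
    by (auto simp: mem_induced_iff)
qed

lemma sat_C2_iff:
  assumes "\<forall>(s, \<gamma>)\<in>R. s \<in> skills G"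
  shows "sat_cnf \<sigma> (C2 sv G R) \<longleftrightarrow>
    (\<forall>(s, \<gamma>)\<in>R. \<exists>w. (s, w) \<in> induced G \<sigma> \<and> models_constraint sv w \<gamma>)"
proof -
  have "sat_cnf \<sigma> (C2 sv G R) \<longleftrightarrow> (\<forall>(s, \<gamma>)\<in>R. sat_clause \<sigma> (candidates sv G s \<gamma>))"
    unfolding sat_cnf_def C2_def by blast
  also have "\<dots> \<longleftrightarrow> (\<forall>(s, \<gamma>)\<in>R. \<exists>w. (s, w) \<in> induced G \<sigma> \<and> models_constraint sv w \<gamma>)"
  \<comment> \<open>The congruence rule keeps membership in \<open>R\<close> available, and this is
    what makes each root a skill.\<close>
  proof (intro ball_cong refl, clarify)
    fix s \<gamma>
    assume "(s, \<gamma>) \<in> R"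
    then have "s \<in> skills G"
      using assms by fast
    then show "sat_clause \<sigma> (candidates sv G s \<gamma>) \<longleftrightarrow>
        (\<exists>w. (s, w) \<in> induced G \<sigma> \<and> models_constraint sv w \<gamma>)"
      by (rule sat_candidates_iff)
  qed
  finally show ?thesis .
qed

lemma sat_C3_iff:
  assumes "\<And>s v q \<gamma>. s \<in> skills G \<Longrightarrow> (q, \<gamma>) \<in> deps G (s, v) \<Longrightarrow> q \<in> skills G"
  shows "sat_cnf \<sigma> (C3 sv G) \<longleftrightarrow> dependency_complete sv G (induced G \<sigma>)"
proof -
  have "sat_cnf \<sigma> (C3 sv G) \<longleftrightarrow>
    (\<forall>s v q \<gamma>. (s, v) \<in> sat_vars G \<and> (q, \<gamma>) \<in> deps G (s, v) \<longrightarrow>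
      sat_clause \<sigma> (insert (Neg (s, v)) (candidates sv G q \<gamma>)))"
    unfolding sat_cnf_def C3_def by blast
  \<comment> \<open>The leading negative literal acts as an antecedent; joined with
    \<open>(s, v) \<in> sat_vars G\<close> it becomes membership in the induced set.\<close>
  also have "\<dots> \<longleftrightarrow> (\<forall>s v q \<gamma>. (s, v) \<in> induced G \<sigma> \<longrightarrow> (q, \<gamma>) \<in> deps G (s, v) \<longrightarrow>
      sat_clause \<sigma> (candidates sv G q \<gamma>))"
    by (auto simp: mem_induced_iff sat_vars_def)
  also have "\<dots> \<longleftrightarrow> (\<forall>s v q \<gamma>. (s, v) \<in> induced G \<sigma> \<longrightarrow> (q, \<gamma>) \<in> deps G (s, v) \<longrightarrow>
      (\<exists>w. (q, w) \<in> induced G \<sigma> \<and> models_constraint sv w \<gamma>))"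
    using assms mem_induced_iff sat_candidates_iff by metis
  also have "\<dots> \<longleftrightarrow> dependency_complete sv G (induced G \<sigma>)"
    unfolding dependency_complete_def by fast
  finally show ?thesis .
qed

lemma sat_C4_iff:
  assumes "\<And>s v q \<gamma>. s \<in> skills G \<Longrightarrow> (q, \<gamma>) \<in> conflicts G (s, v) \<Longrightarrow> q \<in> skills G"
  shows "sat_cnf \<sigma> (C4 sv G) \<longleftrightarrow> consistent sv G (induced G \<sigma>)"
proof -
  have "sat_cnf \<sigma> (C4 sv G) \<longleftrightarrow>
    (\<forall>s v q \<gamma> w. (s, v) \<in> sat_vars G \<and> (q, \<gamma>) \<in> conflicts G (s, v) \<and>
      w \<in> versions G q \<and> models_constraint sv w \<gamma> \<longrightarrow>
      sat_clause \<sigma> {Neg (s, v), Neg (q, w)})"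
    unfolding sat_cnf_def C4_def by blast
  also have "\<dots> \<longleftrightarrow> (\<forall>s v q \<gamma> w. (s, v) \<in> induced G \<sigma> \<longrightarrow> (q, \<gamma>) \<in> conflicts G (s, v) \<longrightarrow>
      (q, w) \<in> induced G \<sigma> \<longrightarrow> \<not> models_constraint sv w \<gamma>)"
    \<comment> \<open>Since a conflict edge leads to a skill, an available version \<open>w\<close>
      of \<open>q\<close> whose variable is true lies in the induced set.\<close>
    using assms by (simp add: mem_induced_iff sat_vars_def) blast
  also have "\<dots> \<longleftrightarrow> consistent sv G (induced G \<sigma>)"
    unfolding consistent_def by fast
  finally show ?thesis .
qed

lemma sat_C5_iff: "sat_cnf \<sigma> (C5 G A) \<longleftrightarrow> capability_safe G A (induced G \<sigma>)"
proof -
  have "sat_cnf \<sigma> (C5 G A) \<longleftrightarrow>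
    (\<forall>s v. (s, v) \<in> sat_vars G \<and> \<not> caps G (s, v) \<subseteq> A \<longrightarrow> sat_clause \<sigma> {Neg (s, v)})"
    unfolding sat_cnf_def C5_def by blast
  then show ?thesis
    by (auto simp: capability_safe_def induced_def)
qed

text \<open>Stated for a fixed \<open>\<sigma>\<close>, this serves both parts of the theorem: it is
  read forwards for the induced installation and backwards for satisfiability.\<close>

lemma sat_encoding_iff:
  assumes "is_adg CU G" and "\<forall>(s, \<gamma>)\<in>R. s \<in> skills G"
  shows "sat_cnf \<sigma> (encoding sv G R A) \<longleftrightarrow>
    secure sv G A (induced G \<sigma>) \<and> resolves sv G R (induced G \<sigma>)"
proof -
  have C3: "sat_cnf \<sigma> (C3 sv G) \<longleftrightarrow> dependency_complete sv G (induced G \<sigma>)"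
    by (rule sat_C3_iff) (use assms(1) in \<open>unfold is_adg_def, fast\<close>)
  have C4: "sat_cnf \<sigma> (C4 sv G) \<longleftrightarrow> consistent sv G (induced G \<sigma>)"
    by (rule sat_C4_iff) (use assms(1) in \<open>unfold is_adg_def, fast\<close>)
  \<comment> \<open>No clause expresses availability or \<open>installation\<close>; both hold for
    every induced set because it consists of variables.\<close>
  have "\<forall>(s, v)\<in>induced G \<sigma>. v \<in> versions G s"
    by (auto simp: mem_induced_iff)
  then show ?thesis
    unfolding encoding_def secure_def resolves_def sat_cnf_Un sat_C1_iff sat_C2_iff[OF assms(2)]
      C3 C4 sat_C5_iff
    using installation_induced by blast
qed

text \<open>\<open>installation\<close> supplies the skills and \<open>resolves\<close> the
  available versions, so \<open>induced_mem\<close> applies to such an \<open>I\<close>.\<close>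

lemma secure_resolves_subset_sat_vars:
  assumes "secure sv G A I" and "resolves sv G R I"
  shows "I \<subseteq> sat_vars G"
  using assms by (auto simp: secure_def resolves_def installation_def sat_vars_def)

lemma is_lockfile_induced:
  assumes "secure sv G A (induced G \<sigma>)" and "allowed M = A"
  shows "is_lockfile sv sha content G A (induced_lockfile sha content G M \<sigma>)"
  using assms by (simp add: is_lockfile_def induced_lockfile_def)

theorem theorem6p10:
  fixes G :: "('s, 'c) adg"
    and CU A :: "'c set"
    and R :: "('s \<times> vconstraint) set"
    and sv :: "nat \<Rightarrow> semver"
    and sha :: "8 word list \<Rightarrow> 256 word"
    and content :: "'s \<times> nat \<Rightarrow> 8 word list"
  assumes "is_adg CU G"
    and "A \<subseteq> CU"
    and "\<forall>(s, \<gamma>)\<in>R. s \<in> skills G"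
  shows "(satisfiable (encoding sv G R A) \<longleftrightarrow>
            (\<exists>I. secure sv G A I \<and> resolves sv G R I)) \<and>
         (\<forall>\<sigma>. sat_cnf \<sigma> (encoding sv G R A) \<longrightarrow>
            secure sv G A (induced G \<sigma>) \<and>
            resolves sv G R (induced G \<sigma>) \<and>
            (\<forall>M. allowed M = A \<longrightarrow>
               (let L = induced_lockfile sha content G M \<sigma> in
                  is_lockfile sv sha content G A L \<and>
                  dependency_complete sv G (installed L) \<and>
                  consistent sv G (installed L) \<and>
                  capability_safe G (allowed (meta L)) (installed L))))"
proof (intro conjI allI impI)
  note sat_iff = sat_encoding_iff[OF assms(1,3)]
  show "satisfiable (encoding sv G R A) \<longleftrightarrow> (\<exists>I. secure sv G A I \<and> resolves sv G R I)"
  proof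
    assume "satisfiable (encoding sv G R A)"
    then show "\<exists>I. secure sv G A I \<and> resolves sv G R I"
      unfolding satisfiable_def sat_iff by blast
  next
    assume "\<exists>I. secure sv G A I \<and> resolves sv G R I"
    then obtain I where I: "secure sv G A I" "resolves sv G R I"
      by blast
    \<comment> \<open>The witness is the characteristic function of \<open>I\<close>, which induces
      \<open>I\<close> again.\<close>
    then have "sat_cnf (\<lambda>p. p \<in> I) (encoding sv G R A)"
      using induced_mem[OF secure_resolves_subset_sat_vars[OF I]] sat_iff by simp
    then show "satisfiable (encoding sv G R A)"
      unfolding satisfiable_def by blast
  qed
  fix \<sigma>
  assume "sat_cnf \<sigma> (encoding sv G R A)"
  then show secure: "secure sv G A (induced G \<sigma>)" and "resolves sv G R (induced G \<sigma>)"
    unfolding sat_iff by blast+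
  fix M :: "'c metadata"
  assume M: "allowed M = A"
  show "let L = induced_lockfile sha content G M \<sigma> in
      is_lockfile sv sha content G A L \<and>
      dependency_complete sv G (installed L) \<and>
      consistent sv G (installed L) \<and>
      capability_safe G (allowed (meta L)) (installed L)"
    using is_lockfile_induced[OF secure M] by (simp add: Let_def is_lockfile_def secure_def)
qed

end
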